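(* Let $n$ be an odd positive integer and let $h(z)=\sum_{0\leq i\leq n-1}a_iz^i\in\mathbb{F}_2[z]/(z^n-1)$. Then $h(z)=g(z)g^*(z)$ for some $g(z)=\sum_{0\leq i\leq n-1}b_iz^i\in\mathbb{F}_2[z]/(z^n-1)$ if and only if $h(z)$ is symmetric. Furthermore, every symmetric polynomial $h(z)=\sum_{0\leq i\leq n-1}a_iz^i\in\mathbb{F}_2[z]/(z^n-1)$ has a factorization $h(z)=g(z)g^*(z)$ with $$g(z)=\sum_{0\leq i\leq n-1}a_{2i\ (\mathrm{mod}\ n)}z^i.$$
   Context: Elements of $\mathbb{F}_2[z]/(z^n-1)$ are represented by their unique representatives of degree at most $n-1$, and products and equalities are in this ring. For $g(z)=\sum_{0\leq i\leq n-1}b_iz^i\in\mathbb{F}_2[z]/(z^n-1)$, the reciprocal polynomial is $g^*(z)=\sum_{0\leq i\leq n-1}b_iz^{n-i}\pmod{z^n-1}$. A polynomial $\sum_{0\leq i\leq n-1}a_iz^i$ is symmetric if $a_i=a_{n-i}$ for all $1\leq i\leq n-1$. The subscript $2i\ (\mathrm{mod}\ n)$ denotes the residue in $\{0,\ldots,n-1\}$. *)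

theory Defs
  imports "HOL-Library.Z2" "HOL-Computational_Algebra.Polynomial"
begin

text \<open>
  The field \<open>F\<^sub>2\<close> is the type \<^typ>\<open>bit\<close>. The ring \<open>F\<^sub>2[z]/(z^n - 1)\<close> is modelled, for
  \<open>n > 0\<close>, by the unique representatives of degree at most \<open>n - 1\<close>, with products reduced
  modulo \<open>z^n - 1\<close>; equality in the ring is then equality of representatives.
\<close>

definition cyc_modulus :: "nat \<Rightarrow> bit poly" where
  "cyc_modulus n = monom 1 n - 1"

definition cyc_carrier :: "nat \<Rightarrow> bit poly set" where
  "cyc_carrier n = {p. degree p \<le> n - 1}"

definition cyc_mult :: "nat \<Rightarrow> bit poly \<Rightarrow> bit poly \<Rightarrow> bit poly" where
  "cyc_mult n p q = (p * q) mod cyc_modulus n"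

definition reciprocal :: "nat \<Rightarrow> bit poly \<Rightarrow> bit poly" where
  "reciprocal n g = (\<Sum>i = 0..n - 1. monom (coeff g i) (n - i)) mod cyc_modulus n"

definition symmetric :: "nat \<Rightarrow> bit poly \<Rightarrow> bool" where
  "symmetric n p \<longleftrightarrow> (\<forall>i\<in>{1..n - 1}. coeff p i = coeff p (n - i))"

end

theory Submission imports Defs "HOL-Number_Theory.Cong" begin

text \<open>
  Exponents may be read modulo \<open>n\<close>. The coefficient of \<open>z\<^sup>k\<close> in \<open>g g\<^sup>*\<close> is the sum of
  \<open>b\<^sub>i b\<^sub>j\<close> over \<open>i - j = k\<close>, which exchanging \<open>i\<close> and \<open>j\<close> turns into the coefficient of
  \<open>z\<^bsup>-k\<^esup>\<close>; so \<open>g g\<^sup>*\<close> is symmetric. Conversely, if \<open>h\<close> is symmetric then so is the \<open>g\<close> with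
  coefficients \<open>a\<^bsub>2i\<^esub>\<close>, whence \<open>g\<^sup>* = g\<close>. In characteristic \<open>2\<close> squaring is additive, so
  \<open>g g\<^sup>*\<close> is the sum of the \<open>a\<^bsub>2i\<^esub> z\<^bsup>2i\<^esup>\<close>, and this is \<open>h\<close> because doubling permutes the
  residues modulo the odd number \<open>n\<close>.
\<close>

text \<open>As simp rules these turn sums and products of bits into \<open>XOR\<close> and
  \<open>AND\<close>, out of reach of the ring lemmas.\<close>

declare add_bit_eq_xor [simp del] mult_bit_eq_and [simp del]

lemma degree_cyc_modulus:
  assumes "n > 0"
  shows "degree (cyc_modulus n) = n"
proof -
  have "degree (monom (1::bit) n + - 1) = degree (monom (1::bit) n)"
    by (rule degree_add_eq_left) (use assms in \<open>simp add: degree_monom_eq\<close>)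
  then show ?thesis by (simp add: cyc_modulus_def degree_monom_eq)
qed

lemma mod_cyc_modulus_eq_self:
  assumes "n > 0" "degree p \<le> n - 1"
  shows "p mod cyc_modulus n = p"
  using assms by (intro mod_poly_less) (simp add: degree_cyc_modulus)

lemma monom_mod_cyc_modulus:
  assumes "n > 0"
  shows "monom c m mod cyc_modulus n = monom c (m mod n)"
proof (induction m rule: less_induct)
  case (less m)
  show ?case
  proof (cases "m < n")
    case True
    then have "degree (monom c m) \<le> n - 1" by (intro order.trans[OF degree_monom_le]) simp
    with assms True show ?thesis by (simp add: mod_cyc_modulus_eq_self)
  next
    case False
    \<comment> \<open>One division step: the exponent drops by \<open>n\<close> at the cost of a
      multiple of the modulus.\<close>
    have "monom c m = monom c (m - n) + monom c (m - n) * cyc_modulus n"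
      using False by (simp add: cyc_modulus_def algebra_simps mult_monom)
    then have "monom c m mod cyc_modulus n = monom c (m - n) mod cyc_modulus n"
      by (metis mod_mult_self2 mult.commute)
    also have "\<dots> = monom c (m mod n)"
      using less[of "m - n"] assms False by (simp add: le_mod_geq)
    finally show ?thesis .
  qed
qed

lemma sum_monom_mod_cyc_modulus:
  assumes "n > 0"
  shows "(\<Sum>x\<in>A. monom (c x) (e x)) mod cyc_modulus n = (\<Sum>x\<in>A. monom (c x) (e x mod n))"
  by (induction A rule: infinite_finite_induct)
     (simp_all add: poly_mod_add_left monom_mod_cyc_modulus[OF assms])

lemma poly_eq_sum_monom:
  assumes "degree p \<le> m"
  shows "p = (\<Sum>i = 0..m. monom (coeff p i) i)"
  using poly_as_sum_of_monoms'[OF assms] by (simp add: atMost_atLeast0)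

text \<open>The exponent \<open>i + (n - j)\<close> stands for i - j modulo \<open>n\<close> without
  truncated subtraction. \<open>Nat.add_diff_assoc\<close> is removed from the simpset to keep it in
  this shape.\<close>

lemma cyc_mult_reciprocal_eq:
  assumes "n > 0" "g \<in> cyc_carrier n"
  shows "cyc_mult n g (reciprocal n g) =
    (\<Sum>i = 0..n - 1. \<Sum>j = 0..n - 1. monom (coeff g i * coeff g j) ((i + (n - j)) mod n))"
proof -
  have "g * (\<Sum>j = 0..n - 1. monom (coeff g j) (n - j)) =
      (\<Sum>i = 0..n - 1. monom (coeff g i) i) * (\<Sum>j = 0..n - 1. monom (coeff g j) (n - j))"
    using poly_eq_sum_monom[of g "n - 1"] assms(2) by (simp add: cyc_carrier_def)
  also have "\<dots> = (\<Sum>x\<in>{0..n - 1} \<times> {0..n - 1}.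
      monom (coeff g (fst x) * coeff g (snd x)) (fst x + (n - snd x)))"
    by (simp add: sum_product sum.cartesian_product mult_monom case_prod_unfold
        del: Nat.add_diff_assoc)
  finally show ?thesis
    \<comment> \<open>The outer reduction absorbs the one inside \<open>reciprocal\<close>, so the
      unreduced sum may be multiplied.\<close>
    unfolding cyc_mult_def reciprocal_def mod_mult_right_eq
    by (simp add: sum_monom_mod_cyc_modulus[OF assms(1)] sum.cartesian_product case_prod_unfold
        del: Nat.add_diff_assoc)
qed

text \<open>Negating i - j = -k modulo \<open>n\<close> gives j - i = k. The bounds on
  \<open>k\<close> make \<open>n - k\<close> a residue; for \<open>k = 0\<close> it would be
  \<open>n\<close>, which no remainder equals.\<close>

lemma diff_mod_eq_iff_swap:
  fixes i j k n :: nat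
  assumes "i < n" "j < n" "1 \<le> k" "k < n"
  shows "(i + (n - j)) mod n = n - k \<longleftrightarrow> (j + (n - i)) mod n = k"
proof -
  \<comment> \<open>A difference of residues wraps around at most once, so linear arithmetic can
    finish after a case split.\<close>
  have eq: "(x + (n - y)) mod n = (if y \<le> x then x - y else x + n - y)" if "x < n" "y < n" for x y
  proof (cases "y \<le> x")
    case True
    then have "x + (n - y) = (x - y) + n" using that by simp
    then have "(x + (n - y)) mod n = (x - y) mod n" by (simp only: mod_add_self2)
    with True that show ?thesis by simp
  qed (use that in simp)
  show ?thesis using assms by (auto simp: eq simp del: Nat.add_diff_assoc)
qed

lemma symmetric_cyc_mult_reciprocal:
  assumes "n > 0" "g \<in> cyc_carrier n"
  shows "symmetric n (cyc_mult n g (reciprocal n g))"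
  unfolding symmetric_def
proof
  have lt: "i \<in> {0..n - 1} \<longleftrightarrow> i < n" for i
    using assms(1) by auto
  fix k assume "k \<in> {1..n - 1}"
  then have k: "1 \<le> k" "k < n" by auto
  have "coeff (cyc_mult n g (reciprocal n g)) (n - k) =
      (\<Sum>i = 0..n - 1. \<Sum>j = 0..n - 1.
        if (i + (n - j)) mod n = n - k then coeff g i * coeff g j else 0)"
    by (simp add: cyc_mult_reciprocal_eq[OF assms] coeff_sum del: Nat.add_diff_assoc)
  also have "\<dots> = (\<Sum>i = 0..n - 1. \<Sum>j = 0..n - 1.
        if (j + (n - i)) mod n = k then coeff g j * coeff g i else 0)"
    using k by (intro sum.cong refl) (auto simp: diff_mod_eq_iff_swap mult.commute lt simp del: Nat.add_diff_assoc)
  also have "\<dots> = (\<Sum>j = 0..n - 1. \<Sum>i = 0..n - 1.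
        if (j + (n - i)) mod n = k then coeff g j * coeff g i else 0)"
    by (rule sum.swap)
  also have "\<dots> = coeff (cyc_mult n g (reciprocal n g)) k"
    by (simp add: cyc_mult_reciprocal_eq[OF assms] coeff_sum del: Nat.add_diff_assoc)
  finally show "coeff (cyc_mult n g (reciprocal n g)) k =
    coeff (cyc_mult n g (reciprocal n g)) (n - k)" by simp
qed

text \<open>The outer \<open>mod n\<close> sends the index \<open>n\<close> to 0, which covers the
  case \<open>i = 0\<close> left out of \<open>symmetric\<close>.\<close>

lemma coeff_symmetric:
  assumes "symmetric n p" "i < n"
  shows "coeff p ((n - i) mod n) = coeff p i"
  using assms by (cases "i = 0") (auto simp: symmetric_def)

lemma reciprocal_symmetric:
  assumes "n > 0" "g \<in> cyc_carrier n" "symmetric n g"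
  shows "reciprocal n g = g"
proof -
  have inv: "(n - (n - i) mod n) mod n = i" if "i < n" for i
    using that by (cases "i = 0") auto
  have lt: "i \<in> {0..n - 1} \<longleftrightarrow> i < n" for i
    using assms(1) by auto
  have "reciprocal n g = (\<Sum>i = 0..n - 1. monom (coeff g i) ((n - i) mod n))"
    by (simp add: reciprocal_def sum_monom_mod_cyc_modulus[OF assms(1)])
  also have "\<dots> = (\<Sum>i = 0..n - 1. monom (coeff g i) i)"
    \<comment> \<open>Negation modulo \<open>n\<close> is its own inverse, hence both witnesses
      coincide.\<close>
    by (rule sum.reindex_bij_witness[where i = "\<lambda>i. (n - i) mod n" and j = "\<lambda>i. (n - i) mod n"])
       (simp_all only: lt inv coeff_symmetric[OF assms(3)] mod_less_divisor[OF assms(1)])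
  also have "\<dots> = g"
    using poly_eq_sum_monom[of g "n - 1"] assms(2) by (simp add: cyc_carrier_def)
  finally show ?thesis .
qed

lemma bit_poly_add_self: "p + p = (0 :: bit poly)"
proof (rule poly_eqI)
  fix i
  show "coeff (p + p) i = coeff 0 i"
    using mult_2[of "coeff p i"] by (simp only: coeff_add bit_2_eq_0 mult_zero_left coeff_0)
qed

lemma bit_poly_sum_square:
  fixes f :: "'a \<Rightarrow> bit poly"
  shows "(\<Sum>x\<in>A. f x) * (\<Sum>x\<in>A. f x) = (\<Sum>x\<in>A. f x * f x)"
proof (induction A rule: infinite_finite_induct)
  case (insert x A)
  let ?s = "\<Sum>x\<in>A. f x"
  \<comment> \<open>The two equal cross terms are grouped so that they cancel.\<close>
  have "(f x + ?s) * (f x + ?s) = f x * f x + ?s * ?s + (f x * ?s + f x * ?s)"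
    by (simp add: algebra_simps)
  with insert show ?case by (simp only: bit_poly_add_self sum.insert[OF insert.hyps] add_0_right)
qed simp_all

lemma cyc_mult_self:
  assumes "n > 0" "g \<in> cyc_carrier n"
  shows "cyc_mult n g g = (\<Sum>i = 0..n - 1. monom (coeff g i) ((2 * i) mod n))"
proof -
  \<comment> \<open>Squaring a monomial therefore doubles its exponent and keeps its
    coefficient.\<close>
  have idem: "b * b = b" for b :: bit by (cases b) simp_all
  have "(\<Sum>i = 0..n - 1. monom (coeff g i) i) * (\<Sum>i = 0..n - 1. monom (coeff g i) i) =
      (\<Sum>i = 0..n - 1. monom (coeff g i) (2 * i))"
    by (simp add: bit_poly_sum_square mult_monom mult_2 idem)
  then have "g * g = (\<Sum>i = 0..n - 1. monom (coeff g i) (2 * i))"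
    using poly_eq_sum_monom[of g "n - 1"] assms(2) by (simp add: cyc_carrier_def)
  then show ?thesis
    by (simp add: cyc_mult_def sum_monom_mod_cyc_modulus[OF assms(1)])
qed

text \<open>As 2 is invertible modulo an odd \<open>n\<close>, doubling is injective, and an
  injective self-map of a finite set is onto.\<close>

lemma bij_betw_double_mod:
  fixes n :: nat
  assumes "odd n"
  shows "bij_betw (\<lambda>i. (2 * i) mod n) {0..n - 1} {0..n - 1}"
proof -
  have n: "n > 0" using assms by (rule odd_pos)
  have "inj_on (\<lambda>i. (2 * i) mod n) {0..n - 1}"
  proof (rule inj_onI)
    fix x y assume xy: "x \<in> {0..n - 1}" "y \<in> {0..n - 1}" and "(2 * x) mod n = (2 * y) mod n"
    then have "[2 * x = 2 * y] (mod n)" by (simp add: cong_def)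
    moreover have "coprime 2 n" using assms by simp
    ultimately have "[x = y] (mod n)" by (simp add: cong_mult_lcancel_nat)
    moreover have "x < n" "y < n" using xy n by auto
    ultimately show "x = y" by (simp add: cong_less_modulus_unique_nat)
  qed
  moreover have "(2 * i) mod n \<in> {0..n - 1}" for i
    using n mod_less_divisor[OF n, of "2 * i"] by simp
  then have "(\<lambda>i. (2 * i) mod n) ` {0..n - 1} \<subseteq> {0..n - 1}" by blast
  ultimately show ?thesis
    by (simp add: bij_betw_def endo_inj_surj)
qed

lemma cyc_mult_reciprocal_doubled:
  assumes "odd n" and h: "h \<in> cyc_carrier n" "symmetric n h"
  defines "g \<equiv> \<Sum>i = 0..n - 1. monom (coeff h ((2 * i) mod n)) i"
  shows "g \<in> cyc_carrier n" and "h = cyc_mult n g (reciprocal n g)"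
proof -
  have n: "n > 0" using assms(1) by (rule odd_pos)
  have coeff_g: "coeff g i = coeff h ((2 * i) mod n)" if "i < n" for i
    using that by (auto simp: g_def coeff_sum)
  show g: "g \<in> cyc_carrier n"
    unfolding cyc_carrier_def g_def
    by (auto intro!: degree_sum_le order.trans[OF degree_monom_le])
  have "symmetric n g"
    unfolding symmetric_def
  proof
    fix i assume i: "i \<in> {1..n - 1}"
    \<comment> \<open>Both \<open>2 * (n - i)\<close> and \<open>n - (2 * i) mod n\<close> represent
      -2i: adding \<open>2 * i\<close> to either gives a multiple of \<open>n\<close>, and
      \<open>2 * i\<close> is then cancelled.\<close>
    then have "2 * (n - i) + 2 * i = n * 2" by auto
    moreover have "(n - (2 * i) mod n) + 2 * i = n * (1 + (2 * i) div n)"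
      using mult_div_mod_eq[of n "2 * i"] mod_le_divisor[OF n, of "2 * i"]
      unfolding distrib_left by linarith
    ultimately have "[2 * (n - i) + 2 * i = (n - (2 * i) mod n) + 2 * i] (mod n)"
      by (simp only: cong_def mod_mult_self1_is_0)
    then have "(2 * (n - i)) mod n = (n - (2 * i) mod n) mod n"
      using cong_add_rcancel_nat cong_def by metis
    then have "coeff h ((2 * (n - i)) mod n) = coeff h ((2 * i) mod n)"
      using coeff_symmetric[OF h(2)] n by simp
    moreover have "i < n" "n - i < n" using i by auto
    ultimately show "coeff g i = coeff g (n - i)"
      by (simp only: coeff_g)
  qed
  then have "cyc_mult n g (reciprocal n g) = (\<Sum>i = 0..n - 1. monom (coeff g i) ((2 * i) mod n))"
    using n g by (simp add: reciprocal_symmetric cyc_mult_self)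
  also have "\<dots> = (\<Sum>i = 0..n - 1. monom (coeff h ((2 * i) mod n)) ((2 * i) mod n))"
    using n by (intro sum.cong refl) (simp add: coeff_g)
  also have "\<dots> = (\<Sum>k = 0..n - 1. monom (coeff h k) k)"
    by (rule sum.reindex_bij_betw[OF bij_betw_double_mod[OF assms(1)]])
  also have "\<dots> = h"
    using poly_eq_sum_monom[of h "n - 1"] h(1) by (simp add: cyc_carrier_def)
  finally show "h = cyc_mult n g (reciprocal n g)" by simp
qed

theorem theorem4p1:
  fixes n :: nat
  assumes "odd n"
  shows "(\<forall>h\<in>cyc_carrier n.
            (\<exists>g\<in>cyc_carrier n. h = cyc_mult n g (reciprocal n g)) \<longleftrightarrow> symmetric n h) \<and>
         (\<forall>h\<in>cyc_carrier n. symmetric n h \<longrightarrow>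
            (let g = (\<Sum>i = 0..n - 1. monom (coeff h ((2 * i) mod n)) i)
             in g \<in> cyc_carrier n \<and> h = cyc_mult n g (reciprocal n g)))"
  \<comment> \<open>The explicit \<open>g\<close> is also the witness for the existence claim in the
    equivalence.\<close>
  unfolding Let_def
  using symmetric_cyc_mult_reciprocal[OF odd_pos[OF assms]] cyc_mult_reciprocal_doubled[OF assms]
  by blast

end
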